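(* For every integer $n\geq 1$, $$p_{3,1}(n)+p_{3,2}(n)=p(n).$$
   Context: A partition of a non-negative integer $n$ is a finite multiset of positive integers (its parts) summing to $n$; $p(n)$ denotes the number of partitions of $n$. For positive integers $A,a$ and a partition $\pi$, $\mathrm{mex}_{A,a}(\pi)$ is the smallest integer $m$ with $m\geq a$ and $m\equiv a \pmod A$ (i.e. the smallest element of $\{a,a+A,a+2A,\dots\}$) that is not a part of $\pi$. Then $p_{A,a}(n)$ is the number of partitions $\pi$ of $n$ with $\mathrm{mex}_{A,a}(\pi)\equiv a \pmod{2A}$. *)

theory Defs
  imports "HOL-Library.Multiset" "HOL-Number_Theory.Cong"
begin

definition partitions :: "nat \<Rightarrow> nat multiset set" where
  "partitions n = {\<pi>. 0 \<notin># \<pi> \<and> sum_mset \<pi> = n}"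

definition num_partitions :: "nat \<Rightarrow> nat" where
  "num_partitions n = card (partitions n)"

definition mex :: "nat \<Rightarrow> nat \<Rightarrow> nat multiset \<Rightarrow> nat" where
  "mex A a \<pi> = (LEAST m. a \<le> m \<and> [m = a] (mod A) \<and> m \<notin># \<pi>)"

definition p_mex :: "nat \<Rightarrow> nat \<Rightarrow> nat \<Rightarrow> nat" where
  "p_mex A a n = card {\<pi> \<in> partitions n. [mex A a \<pi> = a] (mod (2 * A))}"

text \<open>
  The next two lemmas ensure that \<^const>\<open>card\<close> and the least-element operator
  are not applied outside their meaningful range.
\<close>

lemma finite_partitions: "finite (partitions n)"
proof -
  have "partitions n \<subseteq> mset ` {xs. set xs \<subseteq> {..n} \<and> length xs \<le> n}"
  proof
    fix \<pi> assume "\<pi> \<in> partitions n"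
    then have pos: "0 \<notin># \<pi>" and sum: "sum_mset \<pi> = n"
      by (auto simp: partitions_def)
    obtain xs where xs: "\<pi> = mset xs"
      by (metis ex_mset)
    have "x \<le> n" if "x \<in># \<pi>" for x
      using that sum by (auto dest!: multi_member_split)
    moreover have "size \<pi> \<le> sum_mset \<pi>"
      using pos by (induction \<pi>) auto
    ultimately show "\<pi> \<in> mset ` {xs. set xs \<subseteq> {..n} \<and> length xs \<le> n}"
      using sum xs by auto
  qed
  then show ?thesis
    by (rule finite_subset) (simp add: finite_lists_length_le)
qed

lemma mex_exists:
  fixes A a :: nat
  assumes "A > 0"
  shows "\<exists>m. a \<le> m \<and> [m = a] (mod A) \<and> m \<notin># \<pi>"
proof (rule ccontr)
  assume none: "\<not> ?thesis"
  have "a + k * A \<in># \<pi>" for k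
  proof -
    have "a \<le> a + k * A" and "[a + k * A = a] (mod A)"
      by (auto simp: cong_def)
    with none show ?thesis
      by blast
  qed
  then have "range (\<lambda>k. a + k * A) \<subseteq> set_mset \<pi>"
    by blast
  moreover have "inj (\<lambda>k. a + k * A)"
    using assms by (auto intro!: injI)
  ultimately show False
    using finite_subset[OF _ finite_set_mset] finite_imageD[of _ UNIV] infinite_UNIV_nat by blast
qed

end

theory Submission
  imports Defs "HOL-Computational_Algebra.Formal_Power_Series"
begin

text \<open>
  Writing \<open>p\<^sub>A\<^sub>,\<^sub>a(n)\<close> as an alternating sum over the length \<open>k\<close> of an initial run
  \<open>a, a + A, \<dots>, a + (k - 1) A\<close> of parts, and deleting these parts, gives
  \<open>p\<^sub>A\<^sub>,\<^sub>a(n) = \<Sum>\<^sub>k (-1)^k p(n - ka - A k(k-1)/2)\<close>. For \<open>A = 3\<close> and \<open>a = 1, 2\<close> the numbers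
  subtracted are the two families of generalized pentagonal numbers, so that the claim is Euler's
  recurrence for \<open>p\<close> (in which \<open>k = 0\<close> is counted twice, whence the right-hand side \<open>p(n)\<close>).
  The recurrence follows from a finite form of the pentagonal number theorem due to Shanks.
\<close>

unbundle fps_syntax

section \<open>Generating functions of partitions with restricted parts\<close>

definition partitions_fps :: "nat set \<Rightarrow> int fps" where
  "partitions_fps S = Abs_fps (\<lambda>n. int (card {\<pi> \<in> partitions n. set_mset \<pi> \<subseteq> S}))"

lemma partitions_fps_UNIV_nth: "partitions_fps UNIV $ n = int (num_partitions n)"
  by (simp add: partitions_fps_def num_partitions_def)

text \<open>Deleting \<open>M\<close> is a bijection onto the partitions of
  \<open>n - sum_mset M\<close> with parts in \<open>S\<close>; if \<open>sum_mset M\<close> exceeds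
  \<open>n\<close>, both sides vanish.\<close>

lemma card_partitions_supset:
  assumes "set_mset M \<subseteq> S" "0 \<notin># M"
  shows "int (card {\<pi> \<in> partitions n. set_mset \<pi> \<subseteq> S \<and> M \<subseteq># \<pi>}) =
         (fps_X ^ sum_mset M * partitions_fps S) $ n"
proof (cases "sum_mset M \<le> n")
  case True
  have "bij_betw (\<lambda>\<pi>. \<pi> + M) {\<pi> \<in> partitions (n - sum_mset M). set_mset \<pi> \<subseteq> S}
          {\<pi> \<in> partitions n. set_mset \<pi> \<subseteq> S \<and> M \<subseteq># \<pi>}"
  proof (rule bij_betw_byWitness[where f' = "\<lambda>\<pi>. \<pi> - M"])
    show "(\<lambda>\<pi>. \<pi> - M) ` {\<pi> \<in> partitions n. set_mset \<pi> \<subseteq> S \<and> M \<subseteq># \<pi>}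
            \<subseteq> {\<pi> \<in> partitions (n - sum_mset M). set_mset \<pi> \<subseteq> S}"
      by (auto simp: partitions_def sum_mset_diff dest: in_diffD)
  qed (use assms True in \<open>auto simp: partitions_def\<close>)
  then show ?thesis
    using True by (simp add: bij_betw_same_card[symmetric] fps_X_power_mult_nth partitions_fps_def)
next
  case False
  then have "{\<pi> \<in> partitions n. set_mset \<pi> \<subseteq> S \<and> M \<subseteq># \<pi>} = {}"
    by (auto simp: partitions_def mset_subset_eq_exists_conv)
  then show ?thesis
    unfolding fps_X_power_mult_nth using False by (simp only: card.empty) simp
qed

text \<open>Split the partitions according to whether \<open>Suc k\<close> occurs as a part; if it
  does, one copy can be deleted.\<close>

lemma partitions_fps_atMost_Suc:
  "(1 - fps_X ^ Suc k) * partitions_fps {..Suc k} = partitions_fps {..k}"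
proof -
  have "partitions_fps {..Suc k} $ n =
          partitions_fps {..k} $ n + (fps_X ^ Suc k * partitions_fps {..Suc k}) $ n" for n
  proof -
    have "{\<pi> \<in> partitions n. set_mset \<pi> \<subseteq> {..Suc k}} =
            {\<pi> \<in> partitions n. set_mset \<pi> \<subseteq> {..k}} \<union>
            {\<pi> \<in> partitions n. set_mset \<pi> \<subseteq> {..Suc k} \<and> {#Suc k#} \<subseteq># \<pi>}"
      by (auto simp: subset_iff le_Suc_eq)
    moreover have "{\<pi> \<in> partitions n. set_mset \<pi> \<subseteq> {..k}} \<inter>
            {\<pi> \<in> partitions n. set_mset \<pi> \<subseteq> {..Suc k} \<and> {#Suc k#} \<subseteq># \<pi>} = {}"
      by force
    ultimately have "card {\<pi> \<in> partitions n. set_mset \<pi> \<subseteq> {..Suc k}} =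
            card {\<pi> \<in> partitions n. set_mset \<pi> \<subseteq> {..k}} +
            card {\<pi> \<in> partitions n. set_mset \<pi> \<subseteq> {..Suc k} \<and> {#Suc k#} \<subseteq># \<pi>}"
      by (simp add: card_Un_disjoint finite_partitions)
    then show ?thesis
      using card_partitions_supset[of "{#Suc k#}" "{..Suc k}" n] by (simp add: partitions_fps_def)
  qed
  then show ?thesis
    by (simp add: fps_eq_iff algebra_simps)
qed

lemma partitions_fps_atMost_0: "partitions_fps {..0} = 1"
proof -
  have "{\<pi> \<in> partitions n. set_mset \<pi> \<subseteq> {..0}} = (if n = 0 then {{#}} else {})" for n
  proof -
    have "\<pi> = {#}" if "0 \<notin># \<pi>" "set_mset \<pi> \<subseteq> {..0}" for \<pi> :: "nat multiset"
      using that by (metis atMost_0 set_mset_eq_empty_iff subset_singletonD insertI1)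
    then have "{\<pi> \<in> partitions n. set_mset \<pi> \<subseteq> {..0}} = {\<pi>. \<pi> = {#} \<and> n = 0}"
      unfolding partitions_def by fastforce
    then show ?thesis
      by auto
  qed
  then show ?thesis
    unfolding partitions_fps_def fps_eq_iff by simp
qed

text \<open>Euler's product formula with bounded parts: each factor lowers the bound by one, down to
  the empty partition. No infinite product is needed.\<close>

lemma prod_times_partitions_fps_atMost:
  "(\<Prod>i<m. 1 - fps_X ^ Suc i) * partitions_fps {..m} = 1"
proof (induction m)
  case (Suc m)
  then show ?case
    by (simp only: prod.lessThan_Suc mult.assoc partitions_fps_atMost_Suc)
qed (simp add: partitions_fps_atMost_0 del: atMost_0)

lemma partitions_fps_atMost_nth:
  assumes "n \<le> m"
  shows "partitions_fps {..m} $ n = partitions_fps UNIV $ n"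
proof -
  have "x \<le> m" if "\<pi> \<in> partitions n" "x \<in># \<pi>" for \<pi> x
    using that assms by (auto simp: partitions_def dest!: multi_member_split)
  then have "{\<pi> \<in> partitions n. set_mset \<pi> \<subseteq> {..m}} = partitions n"
    by auto
  then show ?thesis
    by (simp add: partitions_fps_def)
qed

text \<open>No part of a partition of at most \<open>n\<close> exceeds \<open>n\<close>, so up to
  degree \<open>n\<close> the full series may be replaced by the one for \<open>{..n}\<close>, where
  the product is 1.\<close>

lemma prod_times_partitions_fps_nth:
  assumes "n \<ge> 1"
  shows "((\<Prod>i<n. 1 - fps_X ^ Suc i) * partitions_fps UNIV) $ n = 0"
proof -
  have "((\<Prod>i<n. 1 - fps_X ^ Suc i) * partitions_fps UNIV) $ n =
        ((\<Prod>i<n. 1 - fps_X ^ Suc i) * partitions_fps {..n}) $ n"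
    unfolding fps_mult_nth by (intro sum.cong) (auto simp: partitions_fps_atMost_nth)
  then show ?thesis
    using assms by (simp only: prod_times_partitions_fps_atMost) simp
qed

section \<open>The finite pentagonal number theorem\<close>

lemma second_pentagonal_eq: "(\<Sum>i<k. 2 + 3 * i) = (\<Sum>i<k. 1 + 3 * i) + k" for k :: nat
  by (induction k) auto

text \<open>The sums of \<open>1 + 3 * i\<close> and \<open>2 + 3 * i\<close> over
  \<open>i < k\<close> are k(3k-1)/2 and k(3k+1)/2, written without division. The splitting here
  matches the exponents that arise in the induction step of
  \<open>finite_pentagonal\<close>.\<close>

lemma pentagonal_eq: "(\<Sum>i<Suc k. 1 + 3 * i) = Suc k * k + (\<Sum>i<Suc k. Suc i)" for k :: nat
  by (induction k) auto

text \<open>Shanks's identity. The term \<open>k = 0\<close> on the left is the full product, and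
  all other terms have exponents above \<open>m\<close>. The added 1 balances \<open>k = 0\<close>
  being counted twice on the right.\<close>

lemma finite_pentagonal:
  "(\<Sum>k\<le>m. (-1) ^ k * (\<Prod>i=k..<m. 1 - fps_X ^ Suc i) * fps_X ^ (k * m + (\<Sum>i<k. Suc i))) + 1 =
   (\<Sum>k\<le>m. (-1) ^ k * (fps_X ^ (\<Sum>i<k. 1 + 3 * i) + fps_X ^ (\<Sum>i<k. 2 + 3 * i)) :: int fps)"
proof (induction m)
  case (Suc m)
  define T where "T k = (\<Sum>i<k. Suc i)" for k
  define G :: "nat \<Rightarrow> nat \<Rightarrow> int fps" where "G m k = (\<Prod>i=k..<m. 1 - fps_X ^ Suc i)" for m k
  define D where "D k = (-1) ^ k * G m k * fps_X ^ (Suc k * Suc m + T k)" for k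
  have T_Suc: "T (Suc k) = T k + Suc k" for k
    by (simp add: T_def)
  \<comment> \<open>The termwise differences of the sums for \<open>Suc m\<close> and \<open>m\<close> telescope, since
    \<open>G m j = (1 - X^(j+1)) G m (j+1)\<close>.\<close>
  have "(\<Sum>k\<le>j. (-1) ^ k * G (Suc m) k * fps_X ^ (k * Suc m + T k))
          = (\<Sum>k\<le>j. (-1) ^ k * G m k * fps_X ^ (k * m + T k)) - D j" if "j \<le> m" for j
    using that
  proof (induction j)
    case 0
    have "G (Suc m) 0 = G m 0 * (1 - fps_X ^ Suc m)"
      by (simp add: G_def)
    then show ?case
      by (simp add: D_def T_def algebra_simps)
  next
    case (Suc j)
    have G_Suc: "G (Suc m) (Suc j) = G m (Suc j) * (1 - fps_X ^ Suc m)"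
      using Suc.prems by (simp add: G_def)
    have G_j: "G m j = (1 - fps_X ^ Suc j) * G m (Suc j)"
      using Suc.prems by (simp add: G_def prod.atLeast_Suc_lessThan)
    have "(\<Sum>k\<le>j. (-1) ^ k * G (Suc m) k * fps_X ^ (k * Suc m + T k))
          = (\<Sum>k\<le>j. (-1) ^ k * G m k * fps_X ^ (k * m + T k)) - D j"
      using Suc by simp
    then show ?case
      unfolding sum.atMost_Suc D_def G_Suc G_j T_Suc by (simp add: power_add algebra_simps)
  qed
  \<comment> \<open>The boundary term \<open>- D m\<close> and the new term \<open>k = Suc m\<close>
    supply the two powers of X; their exponents are the two pentagonal numbers of index
    \<open>Suc m\<close>.\<close>
  from this[of m] have "(\<Sum>k\<le>Suc m. (-1) ^ k * G (Suc m) k * fps_X ^ (k * Suc m + T k)) =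
      (\<Sum>k\<le>m. (-1) ^ k * G m k * fps_X ^ (k * m + T k)) +
      (-1) ^ Suc m * (fps_X ^ (Suc m * m + T (Suc m)) + fps_X ^ (Suc m * m + T (Suc m) + Suc m))"
    by (simp add: D_def G_def T_Suc algebra_simps)
  moreover have "(\<Sum>i<Suc m. 1 + 3 * i) = Suc m * m + T (Suc m)"
    unfolding T_def by (rule pentagonal_eq)
  moreover have "(\<Sum>i<Suc m. 2 + 3 * i) = Suc m * m + T (Suc m) + Suc m"
    using calculation(2) by (simp only: second_pentagonal_eq)
  ultimately show ?case
    using Suc.IH unfolding T_def[symmetric] G_def[symmetric]
    by (simp only: sum.atMost_Suc[of _ m]) (simp add: algebra_simps)
qed simp

section \<open>Mex counts as alternating sums\<close>

lemma sum_minus_one_power_atMost: "(\<Sum>k\<le>j. (-1) ^ k) = (of_bool (even j) :: int)"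
  by (induction j) auto

text \<open>If \<open>I\<close> is the length of the initial run of parts, the mex is
  \<open>a + I * A\<close>, and \<open>2 * A\<close> divides \<open>I * A\<close> exactly when
  \<open>I\<close> is even.\<close>

lemma mex_cong_iff:
  assumes "A > 0"
  shows "[mex A a \<pi> = a] (mod (2 * A)) \<longleftrightarrow> even (LEAST k. a + k * A \<notin># \<pi>)"
proof -
  define I where "I = (LEAST k. a + k * A \<notin># \<pi>)"
  have run: "\<exists>k. m = a + k * A" if "a \<le> m" "[m = a] (mod A)" for m
    using that by (metis cong_le_nat add.commute mult.commute)
  obtain k where "a + k * A \<notin># \<pi>"
    using mex_exists[OF assms, of a \<pi>] run by blast
  then have I: "a + I * A \<notin># \<pi>"
    unfolding I_def by (rule LeastI)
  have "mex A a \<pi> = a + I * A"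
    unfolding mex_def
  proof (rule Least_equality)
    show "a \<le> a + I * A \<and> [a + I * A = a] (mod A) \<and> a + I * A \<notin># \<pi>"
      using I by (simp add: cong_def)
  next
    fix m assume m: "a \<le> m \<and> [m = a] (mod A) \<and> m \<notin># \<pi>"
    then obtain k where "m = a + k * A"
      using run by blast
    then show "a + I * A \<le> m"
      using m by (auto simp: I_def intro: Least_le)
  qed
  then show ?thesis
    using assms unfolding I_def[symmetric]
    by (simp add: cong_add_lcancel_0_nat cong_0_iff)
qed

lemma mset_set_subseteq_mset_iff:
  assumes "finite S"
  shows "mset_set S \<subseteq># M \<longleftrightarrow> S \<subseteq> set_mset M"
  by (metis assms finite_set_mset finite_set_mset_mset_set mset_set_set_mset_msubset
      set_mset_mono subset_imp_msubset_mset_set subset_mset.trans)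

text \<open>The indicator of an even run length \<open>I\<close> is the sum of
  \<open>(-1) ^ k\<close> over \<open>k \<le> I\<close>. Exchanging summations leaves, for each
  \<open>k\<close>, the number of partitions that contain the first \<open>k\<close> terms of the
  progression.\<close>

lemma p_mex_eq_fps_nth:
  assumes "A > 0" "a > 0"
  shows "int (p_mex A a n) =
    ((\<Sum>k\<le>n. (-1) ^ k * fps_X ^ (\<Sum>i<k. a + A * i)) * partitions_fps UNIV) $ n"
proof -
  define I where "I \<pi> = (LEAST k. a + k * A \<notin># \<pi>)" for \<pi>
  \<comment> \<open>A part \<open>a + n * A\<close> would exceed \<open>n\<close>. This bounds run
    lengths by \<open>n\<close>, which justifies cutting the sum off there.\<close>
  have notin: "a + n * A \<notin># \<pi>" if "\<pi> \<in> partitions n" for \<pi>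
  proof
    assume "a + n * A \<in># \<pi>"
    then have "a + n * A \<le> n"
      using that by (auto simp: partitions_def dest!: multi_member_split)
    moreover have "n \<le> n * A"
      using assms by simp
    ultimately show False
      using assms by linarith
  qed
  have I_le: "I \<pi> \<le> n" if "\<pi> \<in> partitions n" for \<pi>
    using notin[OF that] unfolding I_def by (rule Least_le)
  \<comment> \<open>The terms of the progression are distinct, so a run of length at least
    \<open>k\<close> is a multiset inclusion, as \<open>card_partitions_supset\<close>
    requires.\<close>
  have run: "{\<pi> \<in> partitions n. k \<le> I \<pi>} =
      {\<pi> \<in> partitions n. mset_set ((\<lambda>i. a + A * i) ` {..<k}) \<subseteq># \<pi>}" for k
  proof -
    have "k \<le> I \<pi> \<longleftrightarrow> (\<forall>i<k. a + i * A \<in># \<pi>)" if "\<pi> \<in> partitions n" for \<pi>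
    proof
      assume "\<forall>i<k. a + i * A \<in># \<pi>"
      moreover have "a + I \<pi> * A \<notin># \<pi>"
        using notin[OF that] unfolding I_def by (rule LeastI)
      ultimately show "k \<le> I \<pi>"
        by (meson not_le)
    qed (unfold I_def, meson less_le_trans not_less_Least)
    then show ?thesis
      by (auto simp: mset_set_subseteq_mset_iff mult.commute)
  qed
  have card: "int (card {\<pi> \<in> partitions n. k \<le> I \<pi>}) =
      (fps_X ^ (\<Sum>i<k. a + A * i) * partitions_fps UNIV) $ n" for k
  proof -
    have "inj_on (\<lambda>i. a + A * i) {..<k}"
      using assms by (auto intro: inj_onI)
    then have "sum_mset (mset_set ((\<lambda>i. a + A * i) ` {..<k})) = (\<Sum>i<k. a + A * i)"
      by (simp add: sum_unfold_sum_mset image_mset_mset_set)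
    moreover have "0 \<notin> (\<lambda>i. a + A * i) ` {..<k}"
      using assms by auto
    ultimately show ?thesis
      using card_partitions_supset[of "mset_set ((\<lambda>i. a + A * i) ` {..<k})" UNIV n]
      by (simp add: run)
  qed
  have "p_mex A a n = card {\<pi> \<in> partitions n. even (I \<pi>)}"
    using assms by (simp add: p_mex_def mex_cong_iff I_def)
  then have "int (p_mex A a n) = (\<Sum>\<pi>\<in>partitions n. of_bool (even (I \<pi>)))"
    by (simp add: finite_partitions Int_def)
  also have "\<dots> = (\<Sum>\<pi>\<in>partitions n. \<Sum>k\<le>n. (-1) ^ k * of_bool (k \<le> I \<pi>))"
  proof (rule sum.cong)
    fix \<pi> assume "\<pi> \<in> partitions n"
    then have "{..n} \<inter> {k. k \<le> I \<pi>} = {..I \<pi>}"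
      using I_le by force
    then show "(of_bool (even (I \<pi>)) :: int) = (\<Sum>k\<le>n. (-1) ^ k * of_bool (k \<le> I \<pi>))"
      by (simp add: sum_minus_one_power_atMost)
  qed simp
  also have "\<dots> = (\<Sum>k\<le>n. (-1) ^ k * int (card {\<pi> \<in> partitions n. k \<le> I \<pi>}))"
    by (subst sum.swap) (simp add: sum_distrib_left[symmetric] finite_partitions Int_def)
  also have "\<dots> = (\<Sum>k\<le>n. (-1) ^ k * (fps_X ^ (\<Sum>i<k. a + A * i) * partitions_fps UNIV) $ n)"
    by (simp only: card)
  also have "\<dots> = (\<Sum>k\<le>n. ((-1) ^ k * fps_X ^ (\<Sum>i<k. a + A * i) * partitions_fps UNIV) $ n)"
    by (intro sum.cong refl) (simp add: minus_one_power_iff)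
  finally show ?thesis
    by (simp add: sum_distrib_right fps_sum_nth)
qed

theorem theorem3p1:
  fixes n :: nat
  assumes "n \<ge> 1"
  shows "p_mex 3 1 n + p_mex 3 2 n = num_partitions n"
proof -
  let ?P = "partitions_fps UNIV"
  let ?t = "\<lambda>k. (-1) ^ k * (\<Prod>i=k..<n. 1 - fps_X ^ Suc i) * fps_X ^ (k * n + (\<Sum>i<k. Suc i)) :: int fps"
  \<comment> \<open>For \<open>k \<ge> 1\<close> the exponent of X is already larger than
    \<open>n\<close>, so only \<open>k = 0\<close> can reach the coefficient at
    \<open>n\<close>.\<close>
  have tail: "(?t k * ?P) $ n = 0" if "k \<in> {..n} - {0}" for k
  proof -
    have "k * n \<ge> n" "(\<Sum>i<k. Suc i) > 0"
      using that by (auto intro!: sum_pos)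
    then have "n < k * n + (\<Sum>i<k. Suc i)"
      by linarith
    moreover have "?t k * ?P = fps_X ^ (k * n + (\<Sum>i<k. Suc i)) *
        ((-1) ^ k * (\<Prod>i=k..<n. 1 - fps_X ^ Suc i) * ?P)"
      by (simp only: mult_ac)
    ultimately show ?thesis
      by (simp only: fps_X_power_mult_nth if_True)
  qed
  have "int (p_mex 3 1 n + p_mex 3 2 n) = ((\<Sum>k\<le>n. (-1) ^ k *
      (fps_X ^ (\<Sum>i<k. 1 + 3 * i) + fps_X ^ (\<Sum>i<k. 2 + 3 * i))) * ?P) $ n"
    by (simp add: p_mex_eq_fps_nth distrib_left distrib_right sum.distrib)
  also have "\<dots> = (((\<Sum>k\<le>n. ?t k) + 1) * ?P) $ n"
    by (simp only: finite_pentagonal)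
  \<comment> \<open>The added 1 of the finite identity is the source of p(n); everything else
    vanishes.\<close>
  also have "\<dots> = (\<Sum>k\<le>n. (?t k * ?P) $ n) + int (num_partitions n)"
    by (simp add: distrib_right sum_distrib_right fps_sum_nth partitions_fps_UNIV_nth)
  also have "(\<Sum>k\<le>n. (?t k * ?P) $ n) = (?t 0 * ?P) $ n"
    using tail by (subst sum.remove[of _ 0]) (auto intro: sum.neutral)
  also have "\<dots> = 0"
    using prod_times_partitions_fps_nth[OF assms] by (simp add: lessThan_atLeast0)
  finally show ?thesis
    by simp
qed

end
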